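(* Suppose $(X,d)$ is a non trivial, locally connected and compact metric space and $f:X\to X$ is an expansive homeomorphism. Then $f$ is not quasi-minimal.
   Context: A homeomorphism $f:X\to X$ on a metric space $(X,d)$ is called expansive if there is a constant $e>0$ such that for all $x\neq y$ in $X$ we have $\sup_{n\in\mathbb{Z}} d(f^n(x),f^n(y))\ge e$. The system $(X,f)$ (or simply $f$) is called quasi-minimal if there exists a nonempty open set $X_M\subset X$ such that for each $x\in X_M$ the orbit $O(x)=\{f^k(x):k\in\mathbb{Z}\}$ is dense in $X$. "Non trivial" is used in its usual sense: $X$ has more than one point.
   Formalization: "Non trivial" is read as "X is infinite" instead of "X has more than one point", since a cyclic permutation of a finite discrete space with at least two points is an expansive, quasi-minimal homeomorphism. *)

theory Defs
  imports "HOL-Analysis.Analysis"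
begin

text \<open>
  The space is a subset \<open>X\<close> of a metric space type, with the induced metric. The inverse of the
  homeomorphism \<open>f\<close> of \<open>X\<close> is \<open>inv_into X f\<close>, so integer iterates are meant for points of \<open>X\<close> only.
\<close>

definition int_iterate :: "'a set \<Rightarrow> ('a \<Rightarrow> 'a) \<Rightarrow> int \<Rightarrow> 'a \<Rightarrow> 'a" where
  "int_iterate X f n =
     (if 0 \<le> n then f ^^ nat n else inv_into X f ^^ nat (- n))"

definition orbit_on :: "'a set \<Rightarrow> ('a \<Rightarrow> 'a) \<Rightarrow> 'a \<Rightarrow> 'a set" where
  "orbit_on X f x = range (\<lambda>k. int_iterate X f k x)"

text \<open>The supremum is taken in \<open>ereal\<close>, where it is meaningful for unbounded \<open>X\<close> as well.\<close>

definition expansive_on :: "'a::metric_space set \<Rightarrow> ('a \<Rightarrow> 'a) \<Rightarrow> bool" where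
  "expansive_on X f \<longleftrightarrow>
     (\<exists>e>0. \<forall>x\<in>X. \<forall>y\<in>X. x \<noteq> y \<longrightarrow>
        ereal e \<le> (SUP n. ereal (dist (int_iterate X f n x) (int_iterate X f n y))))"

text \<open>
  Finite spaces with several points are not excluded by these notions: a cyclic permutation of a
  finite space, such as the exchange of the two points of \<open>{0, 1::real}\<close>, is an expansive
  homeomorphism of a compact, locally connected space all of whose orbits are dense. A theorem that
  rules out quasi-minimality must therefore read ``non trivial'' as ``infinite''.
\<close>

definition quasi_minimal_on :: "'a::metric_space set \<Rightarrow> ('a \<Rightarrow> 'a) \<Rightarrow> bool" where
  "quasi_minimal_on X f \<longleftrightarrow>
     (\<exists>U. openin (top_of_set X) U \<and> U \<noteq> {} \<and> (\<forall>x\<in>U. X \<subseteq> closure (orbit_on X f x)))"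

end

theory Submission
  imports Defs
begin

text \<open>
  Suppose that all points of the nonempty open set \<open>U\<close> have dense orbits. A point \<open>x\<close> with a dense
  orbit is not isolated, since \<open>X\<close> is infinite and locally connected; so its orbit returns to \<open>x\<close>
  in the future or in the past (\<open>recurrent\<close>). The contradiction is a point of \<open>U\<close> that returns in
  neither direction. To find it, fix a point \<open>p\<close> of \<open>U\<close>. If the future of \<open>x\<close> stays away from a ball
  around \<open>p\<close>, then \<open>x\<close> cannot return to itself in the future: a return would carry along the whole
  dense orbit of \<open>x\<close>, also its visits to the ball (\<open>recurrent_visits\<close>). The same holds for the past.

  The point is found with continua whose past iterates stay small, called unstable, and those with
  small future iterates, called stable.

  The first ingredient holds for every expansive action (\<open>unstable_avoids_ball\<close>): an unstable
  continuum with more than one point contains a point whose future stays away from some ball around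
  a given aperiodic point \<open>p\<close>. By expansivity the continuum grows, within a uniform time, to a fixed
  size. Then it contains two separated subcontinua of a smaller fixed size. Looked at far enough
  in the past, all their iterates over one growth period are too small, compared to the distance of
  \<open>p\<close> from its next iterates, for both of the subcontinua to enter a tiny ball around \<open>p\<close>. So one of
  them misses it for the whole period; let it grow, and repeat. The nested intersection of the
  pieces is the point.

  The second ingredient uses local connectedness and the dense orbits
  (\<open>unstable_continuum_exists\<close>): every point \<open>y\<close> lies in an unstable continuum with more than one
  point. If it does not, then by boundary bumping the connected sets of a fixed size around the
  points \<open>h (- n) y\<close> keep small iterates up to time \<open>n\<close>, and at a limit of these points there is a
  nonempty open set whose future iterates are all small. Such a set contracts, and a recurrent
  point in it would be periodic (\<open>no_stable_open_set\<close>).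

  Both ingredients apply to the reversed action too. A stable continuum through \<open>p\<close> inside \<open>U\<close>
  contains a point \<open>y\<close> whose past stays away from a ball around \<open>p\<close>. An unstable continuum through \<open>y\<close>
  inside \<open>U\<close> contains a point \<open>x\<close> whose future stays away from such a ball; and its past, being
  asymptotic to that of \<open>y\<close>, does so as well.
\<close>

section \<open>Continua in metric spaces\<close>

text \<open>
  Boundary bumping in the form used below: in a continuum, the component of a closed sublevel set
  \<open>{\<phi> \<le> t}\<close> cannot stay within \<open>{\<phi> < t}\<close>. A finite family of functions is allowed because
  the constraints are bounds on finitely many iterates.
\<close>

lemma boundary_bumping_sublevel:
  fixes \<phi> :: "'i \<Rightarrow> 'a::metric_space \<Rightarrow> real"
  assumes "compact Q" "connected Q" "finite J" and \<phi>: "\<And>j. j \<in> J \<Longrightarrow> continuous_on Q (\<phi> j)"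
    and a: "a \<in> Q" "\<And>j. j \<in> J \<Longrightarrow> \<phi> j a \<le> t" and exceed: "z\<^sub>0 \<in> Q" "j\<^sub>0 \<in> J" "t < \<phi> j\<^sub>0 z\<^sub>0"
  obtains C z j where "compact C" "connected C" "a \<in> C" "C \<subseteq> Q"
    "\<And>z j. \<lbrakk>z \<in> C; j \<in> J\<rbrakk> \<Longrightarrow> \<phi> j z \<le> t" "z \<in> C" "j \<in> J" "\<phi> j z = t"
proof -
  let ?T = "top_of_set Q"
  define S where "S = {z \<in> Q. \<forall>j\<in>J. \<phi> j z \<le> t}"
  define C where "C = connected_component_of_set (subtopology ?T S) a"
  have S_sub: "S \<subseteq> Q" by (auto simp: S_def)
  have closed_S: "closedin ?T S"
  proof -
    have "openin ?T (\<Union>j\<in>J. Q \<inter> \<phi> j -` {t<..})"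
      by (intro openin_Union) (auto intro: continuous_openin_preimage_gen[OF \<phi>])
    then have "closedin ?T (Q - (\<Union>j\<in>J. Q \<inter> \<phi> j -` {t<..}))" by (simp add: closedin_def double_diff)
    moreover have "Q - (\<Union>j\<in>J. Q \<inter> \<phi> j -` {t<..}) = S" by (force simp: S_def)
    ultimately show ?thesis by simp
  qed
  have C_comp: "C \<in> connected_components_of (subtopology ?T S)"
    unfolding C_def using a S_sub
    by (auto simp: connected_component_in_connected_components_of S_def)
  have "C \<inter> ?T frontier_of S \<noteq> {}"
  proof (rule boundary_bumping_theorem_closed)
    show "connected_space ?T" "compact_space ?T"
      using assms by (simp_all add: compact_space_subtopology connected_space_subtopology)
    show "S \<noteq> topspace ?T"
    proof
      assume "S = topspace ?T"
      then have "z\<^sub>0 \<in> S" using exceed by simp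
      then show False using exceed by (force simp: S_def)
    qed
    show "Hausdorff_space ?T" by (simp add: Hausdorff_space_subtopology)
  qed (use closed_S C_comp in auto)
  then obtain z where z: "z \<in> C" "z \<in> ?T frontier_of S" by blast
  define O' where "O' = {z \<in> Q. \<forall>j\<in>J. \<phi> j z < t}"
  have "openin ?T O'"
  proof -
    have "closedin ?T (\<Union>j\<in>J. Q \<inter> \<phi> j -` {t..})"
      using \<open>finite J\<close> by (intro closedin_Union) (auto intro: continuous_closedin_preimage[OF \<phi>])
    then have "openin ?T (Q - (\<Union>j\<in>J. Q \<inter> \<phi> j -` {t..}))" by (simp add: openin_diff)
    moreover have "Q - (\<Union>j\<in>J. Q \<inter> \<phi> j -` {t..}) = O'" by (force simp: O'_def)
    ultimately show ?thesis by simp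
  qed
  moreover have "O' \<subseteq> S" unfolding O'_def S_def by (auto intro: less_imp_le)
  ultimately have "O' \<subseteq> ?T interior_of S" by (intro interior_of_maximal)
  moreover have "?T closure_of S = S" using closed_S by (simp add: closure_of_eq)
  ultimately have "z \<in> S" "z \<notin> O'" using z(2) by (auto simp: frontier_of_def)
  then obtain j where j: "j \<in> J" "\<phi> j z = t" by (force simp: S_def O'_def)
  have C_sub: "C \<subseteq> S"
    using connected_components_of_subset[OF C_comp] by auto
  have "connected C"
    using connectedin_connected_components_of[OF C_comp] by (simp add: connectedin_subtopology)
  moreover have "compact C"
  proof -
    have "closedin (subtopology ?T S) C"
      using C_comp by (rule closedin_connected_components_of)
    then have "closedin ?T C" using closed_S closedin_trans_full by blast
    then show ?thesis using \<open>compact Q\<close> closedin_compact by blast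
  qed
  moreover have "a \<in> C"
    using a by (simp add: C_def connected_component_of_refl S_def)
  ultimately show ?thesis using C_sub S_sub z(1) j by (intro that[of C z j]) (auto simp: S_def)
qed

text \<open>
  The lower bound on \<open>dist a z\<close> says that \<open>C\<close> is as large as it can be expected to be: it reaches the
  sphere around \<open>a\<close>, unless \<open>Q\<close> fits into the ball.
\<close>

lemma shrink_continuum:
  fixes Q :: "'a::metric_space set"
  assumes "compact Q" "connected Q" "a \<in> Q" "0 < r" "b \<in> Q" "b \<noteq> a"
  obtains C z where "compact C" "connected C" "a \<in> C" "C \<subseteq> Q \<inter> cball a r" "z \<in> C" "min r (dist a b) \<le> dist a z"
proof (cases "Q \<subseteq> cball a r")
  case True
  then show ?thesis using assms by (intro that[of Q b]) auto
next
  case False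
  then obtain z\<^sub>0 where z0: "z\<^sub>0 \<in> Q" "r < dist a z\<^sub>0"
    by (meson mem_cball not_le subsetI)
  obtain C z j where "compact C" "connected C" "a \<in> C" "C \<subseteq> Q"
    "\<And>z j. \<lbrakk>z \<in> C; j \<in> {()}\<rbrakk> \<Longrightarrow> dist a z \<le> r" "z \<in> C" "j \<in> {()}" "dist a z = r"
    by (rule boundary_bumping_sublevel[of Q "{()}" "\<lambda>_ z. dist a z" a r z\<^sub>0 "()"])
      (use assms z0 in \<open>auto intro!: continuous_intros\<close>)
  then show ?thesis by (intro that[of C z]) auto
qed

text \<open>
  If two disjoint open sets separated the intersection, compactness would force some \<open>A n\<close> into
  their union, so that they would separate \<open>A n\<close>.
\<close>

lemma nested_continua:
  fixes A :: "nat \<Rightarrow> 'a::metric_space set"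
  assumes compact: "\<And>n. compact (A n)" and connected: "\<And>n. connected (A n)" and dec: "decseq A"
  shows "compact (\<Inter>n. A n)" "connected (\<Inter>n. A n)"
proof -
  let ?I = "\<Inter>n. A n"
  have closed_I: "closed ?I" using compact by (intro closed_INT) (auto intro: compact_imp_closed)
  then have "compact (A 0 \<inter> ?I)" using compact compact_Int_closed by blast
  then show "compact ?I" by (metis INF_lower UNIV_I inf.absorb2)
  show "connected ?I"
    unfolding connected_closedin_eq
  proof clarify
    fix K L
    assume K: "closedin (top_of_set ?I) K" and L: "closedin (top_of_set ?I) L"
      and cover: "K \<union> L = ?I" and disj: "K \<inter> L = {}" and ne: "K \<noteq> {}" "L \<noteq> {}"
    have "closed K" "closed L" using K L closed_I closedin_closed_trans by blast+
    then obtain V W where VW: "open V" "open W" "K \<subseteq> V" "L \<subseteq> W" "V \<inter> W = {}"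
      using t4_space disj by metis
    have "\<exists>n. A n \<subseteq> V \<union> W"
    proof (rule ccontr)
      assume escape: "\<nexists>n. A n \<subseteq> V \<union> W"
      have "(\<Inter>n. A n - (V \<union> W)) \<noteq> {}"
      proof (intro compact_space_imp_nest[of "top_of_set (A 0)"])
        fix n
        have "closed (A n - (V \<union> W))" using VW compact by (intro closed_Diff compact_imp_closed open_Un)
        moreover have "A n - (V \<union> W) \<subseteq> A 0" using dec by (auto simp: decseq_def)
        ultimately show "closedin (top_of_set (A 0)) (A n - (V \<union> W))"
          by (rule closed_subset[rotated])
        show "A n - (V \<union> W) \<noteq> {}" using escape by blast
        show "compact_space (top_of_set (A 0))" using compact by (simp add: compact_space_subtopology)
        show "decseq (\<lambda>n. A n - (V \<union> W))" using dec unfolding decseq_def by blast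
      qed
      then show False using cover VW by auto
    qed
    then obtain n where n: "A n \<subseteq> V \<union> W" by blast
    have sub: "K \<subseteq> A n" "L \<subseteq> A n" using cover by auto
    have meet: "V \<inter> A n \<noteq> {}" using ne(1) sub(1) VW(3) by auto
    have "W \<inter> A n \<noteq> {}" using ne(2) sub(2) VW(4) by auto
    with meet show False
      using connectedD[OF connected[of n] VW(1,2) _ n] VW(5) by auto
  qed
qed

section \<open>Expansive actions of the integers\<close>

text \<open>
  The homeomorphism is replaced by the action of all its iterates: reversing time is then the
  substitution of \<open>h (- n)\<close> for \<open>h n\<close>, and each statement about the future yields one about the past.
\<close>

locale expansive_action =
  fixes X :: "'a::metric_space set" and h :: "int \<Rightarrow> 'a \<Rightarrow> 'a" and c :: real
  assumes compact_X: "compact X"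
    and cont: "continuous_on X (h n)"
    and in_X: "x \<in> X \<Longrightarrow> h n x \<in> X"
    and zero: "x \<in> X \<Longrightarrow> h 0 x = x"
    and add: "x \<in> X \<Longrightarrow> h (m + n) x = h m (h n x)"
    and c_pos: "0 < c"
    and expansive: "\<lbrakk>x \<in> X; y \<in> X; \<And>n. dist (h n x) (h n y) \<le> c\<rbrakk> \<Longrightarrow> x = y"
begin

lemma reversed: "expansive_action X (\<lambda>n. h (- n)) c"
proof
  fix x m n assume x: "x \<in> X"
  show "h (- (m + n)) x = h (- m) (h (- n) x)"
    using add[OF x, of "- m" "- n"] by simp
next
  fix x y assume "x \<in> X" "y \<in> X" "\<And>n. dist (h (- n) x) (h (- n) y) \<le> c"
  then show "x = y" using expansive by (metis minus_minus)
qed (use compact_X cont in_X zero c_pos in auto)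

lemma tendsto_act:
  assumes "s \<longlonglongrightarrow> p" "p \<in> X" "\<And>i. s i \<in> X"
  shows "(\<lambda>i. h n (s i)) \<longlonglongrightarrow> h n p"
  using assms by (intro continuous_on_tendsto_compose[OF cont]) auto

lemma act_back: "x \<in> X \<Longrightarrow> h (- n) (h n x) = x" "x \<in> X \<Longrightarrow> h n (h (- n) x) = x"
  using add[of x "- n" n] add[of x n "- n"] zero by simp_all

text \<open>
  A limit of counterexamples would be a pair of distinct points that violates expansivity. In this
  form, which follows the orbits around an arbitrary time \<open>a\<close>, the lemma serves in two ways: pairs
  that stay close over a long time interval are very close in its middle, and pairs that are \<open>\<eta>\<close>
  apart separate by more than \<open>c\<close> within time \<open>N\<close>.
\<close>

lemma uniform_expansivity:
  assumes "0 < \<eta>"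
  obtains N :: int where "0 \<le> N" "\<And>x y a. \<lbrakk>x \<in> X; y \<in> X; \<And>l. \<bar>l - a\<bar> \<le> N \<Longrightarrow> dist (h l x) (h l y) \<le> c\<rbrakk>
    \<Longrightarrow> dist (h a x) (h a y) < \<eta>"
proof -
  have "\<exists>N::nat. \<forall>x\<in>X. \<forall>y\<in>X. (\<forall>l. \<bar>l\<bar> \<le> int N \<longrightarrow> dist (h l x) (h l y) \<le> c) \<longrightarrow> dist x y < \<eta>"
  proof (rule ccontr)
    assume "\<not> ?thesis"
    then have "\<forall>N::nat. \<exists>x y. x \<in> X \<and> y \<in> X \<and> (\<forall>l. \<bar>l\<bar> \<le> int N \<longrightarrow> dist (h l x) (h l y) \<le> c) \<and> \<eta> \<le> dist x y"
      by (metis not_le)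
    then obtain x y where xy: "\<And>N. x N \<in> X" "\<And>N. y N \<in> X"
      "\<And>N l. \<bar>l\<bar> \<le> int N \<Longrightarrow> dist (h l (x N)) (h l (y N)) \<le> c" "\<And>N. \<eta> \<le> dist (x N) (y N)"
      by metis
    have "seq_compact (X \<times> X)" using compact_X compact_Times compact_imp_seq_compact by blast
    then obtain pq r where "pq \<in> X \<times> X" "strict_mono r" and lim: "((\<lambda>N. (x N, y N)) \<circ> r) \<longlonglongrightarrow> pq"
      using seq_compactE[of "X \<times> X" "\<lambda>N. (x N, y N)"] xy by (metis SigmaI)
    then obtain p q where pq: "p \<in> X" "q \<in> X"
      and lims: "(\<lambda>i. x (r i)) \<longlonglongrightarrow> p" "(\<lambda>i. y (r i)) \<longlonglongrightarrow> q"
      using tendsto_fst[OF lim] tendsto_snd[OF lim] by (auto simp: o_def)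
    have "dist (h l p) (h l q) \<le> c" for l
    proof (rule tendsto_upperbound)
      show "(\<lambda>i. dist (h l (x (r i))) (h l (y (r i)))) \<longlonglongrightarrow> dist (h l p) (h l q)"
        using lims pq xy by (intro tendsto_dist tendsto_act) auto
      have "\<bar>l\<bar> \<le> int (r i)" if "nat \<bar>l\<bar> \<le> i" for i
        using that seq_suble[OF \<open>strict_mono r\<close>, of i] by linarith
      then show "\<forall>\<^sub>F i in sequentially. dist (h l (x (r i))) (h l (y (r i))) \<le> c"
        using xy(3) by (intro eventually_sequentiallyI[of "nat \<bar>l\<bar>"]) auto
    qed simp
    then have "p = q" using expansive pq by blast
    moreover have "\<eta> \<le> dist p q"
      using xy(4) by (intro tendsto_lowerbound[OF tendsto_dist[OF lims]]) auto
    ultimately show False using assms by simp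
  qed
  then obtain N :: nat where N:
    "\<And>x y. \<lbrakk>x \<in> X; y \<in> X; \<And>l. \<bar>l\<bar> \<le> int N \<Longrightarrow> dist (h l x) (h l y) \<le> c\<rbrakk> \<Longrightarrow> dist x y < \<eta>"
    by blast
  show ?thesis
  proof (rule that[of "int N"])
    fix x y a assume xy: "x \<in> X" "y \<in> X" and close: "\<And>l. \<bar>l - a\<bar> \<le> int N \<Longrightarrow> dist (h l x) (h l y) \<le> c"
    have "dist (h l (h a x)) (h l (h a y)) \<le> c" if "\<bar>l\<bar> \<le> int N" for l
      using close[of "l + a"] that add xy by simp
    then show "dist (h a x) (h a y) < \<eta>" using N xy in_X by blast
  qed simp
qed

lemma equicontinuous:
  fixes N :: int
  assumes "0 < \<eta>" "0 \<le> N"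
  obtains \<rho> where "0 < \<rho>"
    "\<And>x y l. \<lbrakk>x \<in> X; y \<in> X; dist x y \<le> \<rho>; \<bar>l\<bar> \<le> N\<rbrakk> \<Longrightarrow> dist (h l x) (h l y) < \<eta>"
proof -
  have "\<exists>d>0. \<forall>x\<in>X. \<forall>y\<in>X. dist x y \<le> d \<longrightarrow> dist (h l x) (h l y) < \<eta>" for l
  proof -
    have "uniformly_continuous_on X (h l)"
      using cont compact_X compact_uniformly_continuous by blast
    then obtain d where "d > 0" "\<forall>x\<in>X. \<forall>y\<in>X. dist y x < d \<longrightarrow> dist (h l y) (h l x) < \<eta>"
      using assms unfolding uniformly_continuous_on_def by blast
    then show ?thesis by (intro exI[of _ "d / 2"]) (auto simp: dist_commute)
  qed
  then obtain d where d: "\<And>l. 0 < d l" "\<And>l x y. \<lbrakk>x \<in> X; y \<in> X; dist x y \<le> d l\<rbrakk> \<Longrightarrow> dist (h l x) (h l y) < \<eta>"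
    by metis
  let ?L = "{- N..N}"
  show ?thesis
  proof (rule that[of "Min (d ` ?L)"])
    show "0 < Min (d ` ?L)" using d(1) \<open>0 \<le> N\<close> by (subst Min_gr_iff) auto
    fix x y l assume "x \<in> X" "y \<in> X" "dist x y \<le> Min (d ` ?L)" "\<bar>l\<bar> \<le> N"
    moreover have "Min (d ` ?L) \<le> d l" using \<open>\<bar>l\<bar> \<le> N\<close> by (intro Min_le finite_imageI imageI) auto
    ultimately show "dist (h l x) (h l y) < \<eta>" using d(2) by force
  qed
qed

section \<open>Unstable continua and the points in them that avoid a ball\<close>

text \<open>
  By uniform expansivity the past iterates of such a set do not just stay small, they shrink to \<open>0\<close>.
  The bound is required at time \<open>0\<close> too, so that every pair of points of the set has to separate in
  the future.
\<close>

definition unstable :: "'a set \<Rightarrow> bool" where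
  "unstable Q \<longleftrightarrow> compact Q \<and> connected Q \<and> Q \<subseteq> X \<and>
     (\<forall>x\<in>Q. \<forall>y\<in>Q. \<forall>i\<le>0. dist (h i x) (h i y) \<le> c)"

lemma unstable_subset: "\<lbrakk>unstable Q; compact C; connected C; C \<subseteq> Q\<rbrakk> \<Longrightarrow> unstable C"
  unfolding unstable_def by blast

text \<open>
  Stopping at the first time \<open>n \<ge> 0\<close> at which the iterate has size \<open>\<delta>\<close> keeps it unstable: if \<open>n > 0\<close>,
  one step earlier it was smaller than \<open>\<delta>\<close>, and \<open>\<delta>\<close> is chosen such that one step takes it at most to size \<open>c\<close>.
\<close>

lemma unstable_grows:
  assumes P: "unstable P" and ab: "a \<in> P" "b \<in> P" "\<delta> \<le> dist (h l a) (h l b)" "0 \<le> l"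
    and \<delta>: "\<delta> \<le> c" "\<forall>x\<in>X. \<forall>y\<in>X. dist x y \<le> \<delta> \<longrightarrow> dist (h 1 x) (h 1 y) \<le> c"
  obtains n x y where "0 \<le> n" "n \<le> l" "unstable (h n ` P)" "x \<in> P" "y \<in> P" "\<delta> \<le> dist (h n x) (h n y)"
proof -
  define n where "n = (LEAST n::nat. \<exists>x\<in>P. \<exists>y\<in>P. \<delta> \<le> dist (h (int n) x) (h (int n) y))"
  have "\<exists>x\<in>P. \<exists>y\<in>P. \<delta> \<le> dist (h (int (nat l)) x) (h (int (nat l)) y)" using ab by auto
  then have large: "\<exists>x\<in>P. \<exists>y\<in>P. \<delta> \<le> dist (h (int n) x) (h (int n) y)" and "n \<le> nat l"
    unfolding n_def by (rule LeastI, rule Least_le)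
  have PX: "P \<subseteq> X" using P by (simp add: unstable_def)
  have small: "dist (h i x) (h i y) \<le> \<delta>" if "0 \<le> i" "i < int n" "x \<in> P" "y \<in> P" for i x y
  proof -
    have "nat i < n" using that by simp
    from not_less_Least[OF this[unfolded n_def]] have "dist (h i x) (h i y) < \<delta>"
      using that by (auto simp: not_le)
    then show ?thesis by simp
  qed
  have past: "dist (h i x) (h i y) \<le> c" if "i \<le> int n" "x \<in> P" "y \<in> P" for i x y
  proof (cases "i \<le> 0")
    case True
    then show ?thesis using P that by (simp add: unstable_def)
  next
    case False
    have "dist (h (i - 1) x) (h (i - 1) y) \<le> \<delta>" using small False that by simp
    then have "dist (h 1 (h (i - 1) x)) (h 1 (h (i - 1) y)) \<le> c"
      using \<delta>(2) in_X PX that by blast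
    then show ?thesis
      using add[of x 1 "i - 1"] add[of y 1 "i - 1"] subsetD[OF PX that(2)] subsetD[OF PX that(3)] by simp
  qed
  have "unstable (h (int n) ` P)"
    unfolding unstable_def
  proof (intro conjI ballI allI impI)
    show "compact (h (int n) ` P)" "connected (h (int n) ` P)"
      using P PX by (auto simp: unstable_def intro!: compact_continuous_image connected_continuous_image
          continuous_on_subset[OF cont])
    show "h (int n) ` P \<subseteq> X" using in_X PX by blast
    fix u v i assume "u \<in> h (int n) ` P" "v \<in> h (int n) ` P" "i \<le> (0::int)"
    then show "dist (h i u) (h i v) \<le> c"
      using past[of "i + int n"] add[of _ i "int n"] PX by (auto simp: subset_iff)
  qed
  then show ?thesis using that[of "int n"] large \<open>n \<le> nat l\<close> ab(4) by auto
qed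

text \<open>
  An iterated selection of subcontinua. All pieces are chosen at a time at which their size is
  comparable to \<open>\<delta>\<close>, but their visits to the ball around \<open>p\<close> are watched \<open>k\<close> units of time earlier, where they
  are so small that they follow the orbit of a single point.
\<close>

lemma unstable_avoids_ball:
  assumes p: "p \<in> X" "\<And>m. 0 < m \<Longrightarrow> h m p \<noteq> p"
    and \<Lambda>: "unstable \<Lambda>" "a\<^sub>0 \<in> \<Lambda>" "b\<^sub>0 \<in> \<Lambda>" "b\<^sub>0 \<noteq> a\<^sub>0"
  obtains x r T where "x \<in> \<Lambda>" "0 < r" "\<And>t. T \<le> t \<Longrightarrow> r \<le> dist (h t x) p"
proof -
  obtain \<delta> where "0 < \<delta>" "\<delta> \<le> c"
    and \<delta>: "\<forall>x\<in>X. \<forall>y\<in>X. dist x y \<le> \<delta> \<longrightarrow> dist (h 1 x) (h 1 y) \<le> c"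
  proof -
    obtain \<rho> where "0 < \<rho>" "\<And>x y l. \<lbrakk>x \<in> X; y \<in> X; dist x y \<le> \<rho>; \<bar>l\<bar> \<le> 1\<rbrakk> \<Longrightarrow> dist (h l x) (h l y) < c"
      using equicontinuous[OF c_pos zero_le_one] by metis
    then show ?thesis using c_pos by (intro that[of "min \<rho> c"]) (auto intro: less_imp_le)
  qed
  \<comment> \<open>\<open>N\<close> bounds the time that a piece of size \<open>\<delta> / 4\<close> needs to grow to size \<open>\<delta>\<close>.\<close>
  have "0 < \<delta> / 4" "0 < \<delta> / 2" using \<open>0 < \<delta>\<close> by auto
  obtain N where "0 \<le> N" and N: "\<And>x y a. \<lbrakk>x \<in> X; y \<in> X; \<And>l. \<bar>l - a\<bar> \<le> N \<Longrightarrow> dist (h l x) (h l y) \<le> c\<rbrakk>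
      \<Longrightarrow> dist (h a x) (h a y) < \<delta> / 4"
    using uniform_expansivity[OF \<open>0 < \<delta> / 4\<close>] by metis
  \<comment> \<open>Sets of size less than \<open>s\<close> do not meet \<open>p\<close> and one of its next \<open>N\<close> iterates at once.\<close>
  define s where "s = Min (insert 1 ((\<lambda>i. dist (h i p) p) ` {1..N}))"
  have "0 < s" unfolding s_def using p(2) by (subst Min_gr_iff) auto
  have s: "s \<le> dist (h i p) p" if "0 < i" "i \<le> N" for i
    unfolding s_def using that by (intro Min_le) auto
  have "0 < s / 4" using \<open>0 < s\<close> by simp
  obtain M where "0 \<le> M" and M: "\<And>x y a. \<lbrakk>x \<in> X; y \<in> X; \<And>l. \<bar>l - a\<bar> \<le> M \<Longrightarrow> dist (h l x) (h l y) \<le> c\<rbrakk>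
      \<Longrightarrow> dist (h a x) (h a y) < s / 4"
    using uniform_expansivity[OF \<open>0 < s / 4\<close>] by metis
  \<comment> \<open>From time \<open>- M\<close> backwards an unstable set has size less than \<open>s / 4\<close>; so with this \<open>k\<close> it does
    during all of \<open>{- k..N - k}\<close>.\<close>
  define k where "k = N + M"
  have "0 \<le> k" using \<open>0 \<le> N\<close> \<open>0 \<le> M\<close> by (simp add: k_def)
  obtain \<rho>\<^sub>1 where "0 < \<rho>\<^sub>1"
    and \<rho>1: "\<And>x y l. \<lbrakk>x \<in> X; y \<in> X; dist x y \<le> \<rho>\<^sub>1; \<bar>l\<bar> \<le> k\<rbrakk> \<Longrightarrow> dist (h l x) (h l y) < \<delta> / 2"
    using equicontinuous[OF \<open>0 < \<delta> / 2\<close> \<open>0 \<le> k\<close>] by metis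
  obtain \<rho>\<^sub>2 where "0 < \<rho>\<^sub>2"
    and \<rho>2: "\<And>x y l. \<lbrakk>x \<in> X; y \<in> X; dist x y \<le> \<rho>\<^sub>2; \<bar>l\<bar> \<le> N\<rbrakk> \<Longrightarrow> dist (h l x) (h l y) < s / 4"
    using equicontinuous[OF \<open>0 < s / 4\<close> \<open>0 \<le> N\<close>] by metis
  define r where "r = Min {s / 4, \<rho>\<^sub>1 / 2, \<rho>\<^sub>2}"
  have "0 < r" "r \<le> s / 4" "r \<le> \<rho>\<^sub>1 / 2" "r \<le> \<rho>\<^sub>2"
    using \<open>0 < s\<close> \<open>0 < \<rho>\<^sub>1\<close> \<open>0 < \<rho>\<^sub>2\<close> by (auto simp: r_def)
  \<comment> \<open>Simultaneous visits would make \<open>x\<close> and \<open>y\<close> too close at time \<open>0\<close>. Visits at times \<open>i < j\<close> would make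
    \<open>p\<close> nearly return after time \<open>j - i\<close>, as the orbits of \<open>x\<close> and \<open>y\<close> are close all the time.\<close>
  have no_double_visit: False
    if Q: "unstable Q" "x \<in> Q" "y \<in> Q" and far: "\<delta> / 2 \<le> dist x y" and ij: "0 \<le> i" "i \<le> j" "j \<le> N"
      and near: "dist (h (i - k) x) p < r" "dist (h (j - k) y) p < r" for Q x y i j
  proof -
    have X: "x \<in> X" "y \<in> X" using Q by (auto simp: unstable_def)
    show False
    proof (cases "i = j")
      case True
      have "dist (h (i - k) x) (h (i - k) y) < 2 * r"
        using near dist_triangle2[of "h (i - k) x" "h (i - k) y" p] True by simp
      then have "dist (h (i - k) x) (h (i - k) y) \<le> \<rho>\<^sub>1" using \<open>r \<le> \<rho>\<^sub>1 / 2\<close> by simp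
      moreover have "\<bar>k - i\<bar> \<le> k" using ij \<open>0 \<le> M\<close> by (auto simp: k_def)
      ultimately have "dist (h (k - i) (h (i - k) x)) (h (k - i) (h (i - k) y)) < \<delta> / 2"
        using \<rho>1 in_X X by blast
      then show False using far act_back(2)[of _ "k - i"] X by simp
    next
      case False
      have "\<bar>j - i\<bar> \<le> N" "0 < j - i" "j - i \<le> N" using ij False by auto
      have "dist (h (j - i) (h (i - k) x)) (h (j - i) p) < s / 4"
        using \<rho>2[OF in_X[OF X(1)] p(1) _ \<open>\<bar>j - i\<bar> \<le> N\<close>] near(1) \<open>r \<le> \<rho>\<^sub>2\<close> by force
      then have "dist (h (j - k) x) (h (j - i) p) < s / 4"
        using add[OF X(1), of "j - i" "i - k"] by simp
      moreover have "dist (h (j - k) x) (h (j - k) y) < s / 4"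
      proof (rule M[OF X])
        fix l assume "\<bar>l - (j - k)\<bar> \<le> M"
        then have "l \<le> 0" using ij by (auto simp: k_def)
        then show "dist (h l x) (h l y) \<le> c" using Q by (simp add: unstable_def)
      qed
      ultimately have "dist (h (j - i) p) p < s"
        using near(2) \<open>r \<le> s / 4\<close> dist_triangle3[of "h (j - i) p" p "h (j - k) x"]
          dist_triangle[of "h (j - k) x" p "h (j - k) y"] \<open>0 < s\<close> by linarith
      then show False using s[OF \<open>0 < j - i\<close> \<open>j - i \<le> N\<close>] by simp
    qed
  qed
  define large where "large Q \<longleftrightarrow> unstable Q \<and> (\<exists>x\<in>Q. \<exists>y\<in>Q. \<delta> \<le> dist x y)" for Q
  have piece: "\<exists>P a z. unstable P \<and> P \<subseteq> Q \<and> P \<subseteq> cball a (\<delta> / 4) \<and> a \<in> P \<and> z \<in> P \<and> \<delta> / 4 \<le> dist a z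
      \<and> (\<forall>x\<in>P. \<forall>j\<in>{0..N}. r \<le> dist (h (j - k) x) p)" if "large Q" for Q
  proof -
    obtain a b where ab: "a \<in> Q" "b \<in> Q" "\<delta> \<le> dist a b" using \<open>large Q\<close> by (auto simp: large_def)
    have Q: "compact Q" "connected Q" "unstable Q" using \<open>large Q\<close> by (auto simp: large_def unstable_def)
    have "a \<noteq> b" using ab(3) \<open>0 < \<delta>\<close> by auto
    obtain A y where A: "compact A" "connected A" "a \<in> A" "A \<subseteq> Q \<inter> cball a (\<delta> / 4)" "y \<in> A" "min (\<delta> / 4) (dist a b) \<le> dist a y"
      using shrink_continuum[OF Q(1,2) ab(1) \<open>0 < \<delta> / 4\<close> ab(2)] \<open>a \<noteq> b\<close> by metis
    obtain B z where B: "compact B" "connected B" "b \<in> B" "B \<subseteq> Q \<inter> cball b (\<delta> / 4)" "z \<in> B" "min (\<delta> / 4) (dist b a) \<le> dist b z"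
      using shrink_continuum[OF Q(1,2) ab(2) \<open>0 < \<delta> / 4\<close> ab(1)] \<open>a \<noteq> b\<close> by metis
    have "unstable A" "unstable B" using Q(3) A B by (auto intro: unstable_subset)
    have far: "\<delta> / 2 \<le> dist u v" if "u \<in> A" "v \<in> B" for u v
    proof -
      have "dist a u \<le> \<delta> / 4" "dist b v \<le> \<delta> / 4" using that A B by auto
      then show ?thesis using ab(3) dist_triangle[of a b u] dist_triangle2[of u b v] by linarith
    qed
    have "(\<forall>x\<in>A. \<forall>j\<in>{0..N}. r \<le> dist (h (j - k) x) p) \<or> (\<forall>x\<in>B. \<forall>j\<in>{0..N}. r \<le> dist (h (j - k) x) p)"
    proof (rule ccontr)
      assume "\<not> ?thesis"
      then obtain u i v j where u: "u \<in> A" "i \<in> {0..N}" "dist (h (i - k) u) p < r"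
        and v: "v \<in> B" "j \<in> {0..N}" "dist (h (j - k) v) p < r" by (auto simp: not_le)
      have "u \<in> Q" "v \<in> Q" using u v A B by auto
      then show False
        using no_double_visit[OF Q(3), of u v i j] no_double_visit[OF Q(3), of v u j i] far[OF u(1) v(1)] u v
        by (cases "i \<le> j") (auto simp: dist_commute)
    qed
    moreover have "\<delta> / 4 \<le> dist a y" "\<delta> / 4 \<le> dist b z"
      using A(6) B(6) ab(3) \<open>0 < \<delta>\<close> by (auto simp: dist_commute)
    ultimately show ?thesis using A B \<open>unstable A\<close> \<open>unstable B\<close> by (metis le_inf_iff)
  qed
  \<comment> \<open>The pieces are pulled back to time \<open>0\<close>, where they form a decreasing sequence in \<open>\<Lambda>\<close>.\<close>
  define good where "good S T \<longleftrightarrow> compact S \<and> S \<subseteq> \<Lambda> \<and> large (h T ` S)" for S T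
  have \<Lambda>X: "\<Lambda> \<subseteq> X" using \<Lambda> by (simp add: unstable_def)
  have step: "\<exists>S' T'. good S' T' \<and> S' \<subseteq> S \<and> T < T' \<and> (\<forall>x\<in>S'. \<forall>t\<in>{T..T'}. r \<le> dist (h (t - k) x) p)"
    if "good S T" for S T
  proof -
    have SX: "S \<subseteq> X" using that \<Lambda>X by (auto simp: good_def)
    obtain P a z where P: "unstable P" "P \<subseteq> h T ` S" "P \<subseteq> cball a (\<delta> / 4)" "a \<in> P" "z \<in> P" "\<delta> / 4 \<le> dist a z"
      and avoid: "\<forall>x\<in>P. \<forall>j\<in>{0..N}. r \<le> dist (h (j - k) x) p"
      using piece[of "h T ` S"] \<open>good S T\<close> unfolding good_def by metis
    have PX: "P \<subseteq> X" using P by (simp add: unstable_def)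
    have az: "a \<in> X" "z \<in> X" "\<delta> / 4 \<le> dist (h 0 a) (h 0 z)" 
      using P(4-6) subsetD[OF PX] zero by auto
    obtain l where l: "\<bar>l\<bar> \<le> N" "c < dist (h l a) (h l z)"
      using N[OF az(1,2), of 0] az(3) by fastforce
    have "0 \<le> l"
    proof (rule ccontr)
      assume "\<not> 0 \<le> l"
      then have "dist (h l a) (h l z) \<le> c" using P(1,4,5) by (simp add: unstable_def)
      then show False using l(2) by simp
    qed
    have "\<delta> \<le> dist (h l a) (h l z)" using l(2) \<open>\<delta> \<le> c\<close> by simp
    then obtain n x y where n: "0 \<le> n" "n \<le> l" "unstable (h n ` P)" "x \<in> P" "y \<in> P" "\<delta> \<le> dist (h n x) (h n y)"
      using unstable_grows[OF P(1,4,5) _ \<open>0 \<le> l\<close> \<open>\<delta> \<le> c\<close> \<delta>] by metis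
    have "n \<noteq> 0"
    proof
      assume "n = 0"
      then have "\<delta> \<le> dist x y" using n(4-6) subsetD[OF PX] zero by simp
      moreover have "dist a x \<le> \<delta> / 4" "dist a y \<le> \<delta> / 4" using n(4,5) P(3) by auto
      ultimately show False using dist_triangle3[of x y a] \<open>0 < \<delta>\<close> by linarith
    qed
    define S' where "S' = h (- T) ` P"
    have "S' \<subseteq> S"
    proof
      fix x assume "x \<in> S'"
      then obtain u where "u \<in> S" "x = h (- T) (h T u)" using P(2) unfolding S'_def by blast
      then show "x \<in> S" using act_back(1) subsetD[OF SX] by simp
    qed
    moreover have "h (T + n) (h (- T) w) = h n w" if "w \<in> P" for w
      using add[of w "T + n" "- T"] subsetD[OF PX that] by simp
    then have "h (T + n) ` S' = h n ` P" unfolding S'_def image_image by (intro image_cong) auto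
    moreover have "large (h n ` P)" using n by (auto simp: large_def)
    moreover have "compact S'"
      unfolding S'_def using P(1) PX
      by (auto simp: unstable_def intro!: compact_continuous_image continuous_on_subset[OF cont])
    moreover have "r \<le> dist (h (t - k) x) p" if x: "x \<in> S'" and t: "t \<in> {T..T + n}" for x t
    proof -
      obtain w where w: "w \<in> P" "x = h (- T) w" using x by (auto simp: S'_def)
      have "w \<in> X" using w PX by blast
      then have "h (t - k) x = h (t - T - k) w" using add[of w "t - k" "- T"] w(2) by (simp add: algebra_simps)
      then show ?thesis using avoid w(1) t n(2) l(1) by simp
    qed
    ultimately show ?thesis using that n(1) \<open>n \<noteq> 0\<close> unfolding good_def
      by (intro exI[of _ S'] exI[of _ "T + n"]) auto
  qed
  have start: "\<exists>T. good \<Lambda> T"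
  proof -
    have ab: "a\<^sub>0 \<in> X" "b\<^sub>0 \<in> X" using \<Lambda> \<Lambda>X by auto
    obtain l where l: "c < dist (h l a\<^sub>0) (h l b\<^sub>0)" using expansive[OF ab] \<Lambda>(4) by (metis not_le)
    have "0 \<le> l"
    proof (rule ccontr)
      assume "\<not> 0 \<le> l"
      then have "dist (h l a\<^sub>0) (h l b\<^sub>0) \<le> c" using \<Lambda>(1-3) by (simp add: unstable_def)
      then show False using l by simp
    qed
    have "\<delta> \<le> dist (h l a\<^sub>0) (h l b\<^sub>0)" using l \<open>\<delta> \<le> c\<close> by simp
    then obtain n x y where "unstable (h n ` \<Lambda>)" "x \<in> \<Lambda>" "y \<in> \<Lambda>" "\<delta> \<le> dist (h n x) (h n y)"
      using unstable_grows[OF \<Lambda>(1-3) _ \<open>0 \<le> l\<close> \<open>\<delta> \<le> c\<close> \<delta>] by metis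
    then show ?thesis using \<Lambda>(1) by (intro exI[of _ n]) (auto simp: good_def large_def unstable_def)
  qed
  have "\<exists>F. \<forall>n. case_prod good (F n) \<and> (fst (F (Suc n)) \<subseteq> fst (F n) \<and> snd (F n) < snd (F (Suc n))
      \<and> (\<forall>x\<in>fst (F (Suc n)). \<forall>t\<in>{snd (F n)..snd (F (Suc n))}. r \<le> dist (h (t - k) x) p))"
    using start step by (intro dependent_nat_choice) auto
  then obtain F where F: "\<And>n::nat. good (fst (F n)) (snd (F n))" "\<And>n. fst (F (Suc n)) \<subseteq> fst (F n)"
    "\<And>n. snd (F n) < snd (F (Suc n))"
    "\<And>n x t. \<lbrakk>x \<in> fst (F (Suc n)); t \<in> {snd (F n)..snd (F (Suc n))}\<rbrakk> \<Longrightarrow> r \<le> dist (h (t - k) x) p"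
    unfolding case_prod_unfold by blast
  have "(\<Inter>n. fst (F n)) \<noteq> {}"
  proof (rule compact_space_imp_nest[of "top_of_set \<Lambda>"])
    show "compact_space (top_of_set \<Lambda>)" using \<Lambda>(1) by (simp add: unstable_def compact_space_subtopology)
    show "closedin (top_of_set \<Lambda>) (fst (F n))" for n
      using F(1)[of n] by (auto simp: good_def intro!: closed_subset compact_imp_closed)
    show "fst (F n) \<noteq> {}" for n using F(1)[of n] by (auto simp: good_def large_def)
    show "decseq (\<lambda>n. fst (F n))" using F(2) by (rule decseq_SucI)
  qed
  then obtain x where x: "\<And>n. x \<in> fst (F n)" by blast
  show thesis
  proof (rule that)
    show "x \<in> \<Lambda>" using x[of 0] F(1)[of 0] by (auto simp: good_def)
    fix t assume t: "snd (F 0) - k \<le> t"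
    have "snd (F 0) + int n \<le> snd (F n)" for n
    proof (induction n)
      case (Suc n)
      then show ?case using F(3)[of n] by simp
    qed simp
    from this[of "nat (t + k - snd (F 0))"] have "\<exists>n. t + k \<le> snd (F n)" using t by (intro exI) simp
    then have "\<exists>n. t + k \<in> {snd (F n)..snd (F (Suc n))}"
    proof (elim exE)
      fix n assume "t + k \<le> snd (F n)"
      then show ?thesis
      proof (induction n)
        case 0
        then show ?case using t F(3)[of 0] by (intro exI[of _ 0]) auto
      next
        case (Suc n)
        then show ?case by (cases "t + k \<le> snd (F n)") (auto intro: exI[of _ n])
      qed
    qed
    then show "r \<le> dist (h t x) p" using F(4)[OF x] by force
  qed (rule \<open>0 < r\<close>)
qed

end

section \<open>Recurrence in quasi-minimal actions\<close>

locale quasi_minimal_action = expansive_action +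
  fixes U :: "'a set"
  assumes infinite_X: "infinite X"
    and locally_connected_X: "locally connected X"
    and open_U: "openin (top_of_set X) U"
    and U_ne: "U \<noteq> {}"
    and dense_U: "x \<in> U \<Longrightarrow> X \<subseteq> closure (range (\<lambda>n. h n x))"
begin

lemma quasi_minimal_reversed: "quasi_minimal_action X (\<lambda>n. h (- n)) c U"
proof -
  interpret r: expansive_action X "\<lambda>n. h (- n)" c by (rule reversed)
  have "range (\<lambda>n. h (- n) x) = range (\<lambda>n. h n x)" for x
    using image_image[of "\<lambda>n. h n x" uminus UNIV] by (simp add: surj_uminus)
  then show ?thesis
    using infinite_X locally_connected_X open_U U_ne dense_U by unfold_locales auto
qed

definition dense_orbit :: "'a \<Rightarrow> bool" where
  "dense_orbit x \<longleftrightarrow> x \<in> X \<and> X \<subseteq> closure (range (\<lambda>n. h n x))"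

lemma dense_orbit_U: "x \<in> U \<Longrightarrow> dense_orbit x"
  using dense_U openin_imp_subset[OF open_U] by (auto simp: dense_orbit_def)

lemma dense_orbit_meets:
  assumes "dense_orbit x" "openin (top_of_set X) W" "W \<noteq> {}"
  obtains n where "h n x \<in> W"
proof -
  obtain T where "open T" "W = X \<inter> T" using assms(2) by (auto simp: openin_open)
  moreover then have "T \<inter> closure (range (\<lambda>n. h n x)) \<noteq> {}"
    using assms by (auto simp: dense_orbit_def)
  ultimately have "T \<inter> range (\<lambda>n. h n x) \<noteq> {}" using open_Int_closure_eq_empty by blast
  then show ?thesis using that \<open>W = X \<inter> T\<close> in_X assms(1) by (auto simp: dense_orbit_def)
qed

lemma dense_orbit_act: "dense_orbit x \<Longrightarrow> dense_orbit (h n x)"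
proof -
  assume x: "dense_orbit x"
  have "h k x = h (k - n) (h n x)" for k using x add[of x "k - n" n] by (simp add: dense_orbit_def)
  then have "range (\<lambda>k. h k x) \<subseteq> range (\<lambda>k. h k (h n x))" by blast
  then show ?thesis using x in_X closure_mono unfolding dense_orbit_def by blast
qed

lemma aperiodic:
  assumes "dense_orbit x" "0 < m"
  shows "h m x \<noteq> x"
proof
  assume m: "h m x = x"
  have x: "x \<in> X" using assms by (simp add: dense_orbit_def)
  have mult: "h (int k * m) x = x" for k
    using m x by (induction k) (simp_all add: zero add distrib_right)
  have "h (q * m) x = x" for q
    using mult[of "nat \<bar>q\<bar>"] act_back(1)[OF x, of "- (q * m)"] by (cases "0 \<le> q") auto
  then have "h n x = h (n mod m) x" for n
    using add[OF x, of "n mod m" "n div m * m"] by simp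
  moreover have "n mod m \<in> {0..<m}" for n using assms by simp
  ultimately have "range (\<lambda>n. h n x) \<subseteq> (\<lambda>n. h n x) ` {0..<m}" by blast
  then have "finite (range (\<lambda>n. h n x))" using finite_subset by blast
  then have "closure (range (\<lambda>n. h n x)) = range (\<lambda>n. h n x)"
    by (simp add: finite_imp_closed)
  then have "X \<subseteq> range (\<lambda>n. h n x)" using assms(1) by (simp add: dense_orbit_def)
  then show False using infinite_X \<open>finite (range (\<lambda>n. h n x))\<close> finite_subset by blast
qed

text \<open>
  An isolated point with a dense orbit would make a dense set of points isolated. A connected open
  set contains no isolated point unless it is a singleton, so all points near an accumulation
  point of \<open>X\<close> would coincide with it.
\<close>

lemma dense_orbit_islimpt:
  assumes "dense_orbit x"
  shows "x islimpt X"
proof (rule ccontr)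
  assume "\<not> x islimpt X"
  have x: "x \<in> X" using assms by (simp add: dense_orbit_def)
  obtain T where "x \<in> T" "open T" "\<And>y. y \<in> X \<Longrightarrow> y \<in> T \<Longrightarrow> y = x"
    using \<open>\<not> x islimpt X\<close> unfolding islimpt_def by blast
  then have "X \<inter> T = {x}" using x by blast
  then have open_x: "openin (top_of_set X) {x}" using \<open>open T\<close> by (metis openin_open_Int)
  obtain p where p: "p \<in> X" "p islimpt X"
    using compact_X infinite_X unfolding compact_eq_Bolzano_Weierstrass by blast
  obtain W where W: "openin (top_of_set X) W" "connected W" "p \<in> W"
    using locally_connected_X p(1) unfolding locally_connected by (metis openin_subtopology_self)
  obtain n where n: "h n x \<in> W" using dense_orbit_meets[OF assms W(1)] W(3) by blast
  have "X \<inter> h (- n) -` {x} = {h n x}"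
    using act_back(1)[OF x, of n] act_back(2)[of _ n] in_X[OF x, of n] by auto
  moreover have "openin (top_of_set X) (X \<inter> h (- n) -` {x})"
    using in_X by (intro continuous_openin_preimage[OF cont _ open_x]) auto
  ultimately have open_nx: "openin (top_of_set X) {h n x}" by simp
  then have "openin (top_of_set W) {h n x}"
    using n W(1) openin_imp_subset openin_subset_trans by (metis empty_subsetI insert_subset)
  moreover have "closedin (top_of_set W) {h n x}" using n by (simp add: closed_subset)
  ultimately have "W = {h n x}" using W(2) n unfolding connected_clopen by blast
  then have "openin (top_of_set X) {p}" using open_nx W(3) by simp
  then obtain T' where "open T'" "{p} = X \<inter> T'" unfolding openin_open by blast
  then show False using p(2) unfolding islimpt_def by blast
qed

text \<open>
  A dense orbit visits the neighbourhoods of its non-isolated starting point even after the removal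
  of finitely many points of the orbit. It need not do so in both directions of time.
\<close>

lemma recurrent:
  assumes x: "dense_orbit x"
  obtains (forward) "\<And>r N. 0 < r \<Longrightarrow> \<exists>n\<ge>N. dist (h n x) x < r"
    | (backward) "\<And>r N. 0 < r \<Longrightarrow> \<exists>n\<ge>N. dist (h (- n) x) x < r"
proof -
  have returns: "\<exists>n. N \<le> \<bar>n\<bar> \<and> dist (h n x) x < r" if "0 < r" for r N
  proof -
    let ?F = "(\<lambda>n. h n x) ` {- N..N}"
    have "openin (top_of_set X) (X \<inter> (ball x r - ?F))"
      by (intro openin_open_Int open_Diff finite_imp_closed) auto
    moreover have "infinite (X \<inter> ball x r - ?F)"
      using dense_orbit_islimpt[OF x] that unfolding islimpt_eq_infinite_ball
      by (intro Diff_infinite_finite) auto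
    then have "X \<inter> (ball x r - ?F) \<noteq> {}" by (metis Int_Diff finite.emptyI)
    ultimately obtain n where "h n x \<in> X \<inter> (ball x r - ?F)" by (rule dense_orbit_meets[OF x])
    moreover then have "n \<notin> {- N..N}" by blast
    ultimately show ?thesis by (intro exI[of _ n]) (auto simp: dist_commute)
  qed
  show ?thesis
  proof (rule ccontr)
    assume "\<not> thesis"
    then obtain r N r' N' where "0 < r" "\<And>n. n \<ge> N \<Longrightarrow> r \<le> dist (h n x) x"
      "0 < r'" "\<And>n. n \<ge> N' \<Longrightarrow> r' \<le> dist (h (- n) x) x"
      using forward backward by (metis not_le)
    moreover then obtain n where "max N N' \<le> \<bar>n\<bar>" "dist (h n x) x < min r r'"
      using returns[of "min r r'" "max N N'"] by auto
    ultimately show False by (smt (verit) minus_minus)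
  qed
qed

section \<open>Existence of unstable continua\<close>

text \<open>
  A set whose future iterates remain small contracts under the action. A point of it with a dense
  orbit returns close to itself, in the future or in the past, and comparing two such returns shows
  that it would be periodic.
\<close>

lemma no_stable_open_set:
  assumes W: "openin (top_of_set X) W" "W \<noteq> {}"
    and stable: "\<And>z w j. \<lbrakk>z \<in> W; w \<in> W; 0 \<le> j\<rbrakk> \<Longrightarrow> dist (h j z) (h j w) \<le> c"
  shows False
proof -
  have W_sub: "W \<subseteq> X" using W openin_imp_subset by blast
  have contract: "\<exists>N. \<forall>j\<ge>N. \<forall>z\<in>W. \<forall>w\<in>W. dist (h j z) (h j w) < \<eta>" if "0 < \<eta>" for \<eta>
  proof -
    obtain N where N: "0 \<le> N" "\<And>x y a. \<lbrakk>x \<in> X; y \<in> X; \<And>l. \<bar>l - a\<bar> \<le> N \<Longrightarrow> dist (h l x) (h l y) \<le> c\<rbrakk>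
        \<Longrightarrow> dist (h a x) (h a y) < \<eta>"
      using uniform_expansivity[OF \<open>0 < \<eta>\<close>] by metis
    show ?thesis
    proof (intro exI[of _ N] allI impI ballI)
      fix j z w assume "N \<le> j" "z \<in> W" "w \<in> W"
      then show "dist (h j z) (h j w) < \<eta>" using W_sub by (intro N(2) stable) auto
    qed
  qed
  obtain u where "dense_orbit u" using U_ne dense_orbit_U by blast
  then obtain k where "h k u \<in> W" using dense_orbit_meets W by blast
  moreover define z where "z = h k u"
  ultimately have z: "z \<in> W" "dense_orbit z" using \<open>dense_orbit u\<close> dense_orbit_act by auto
  then have zX: "z \<in> X" by (simp add: dense_orbit_def)
  have W_nbhd: "\<exists>r>0. \<forall>v\<in>X. dist v w < r \<longrightarrow> v \<in> W" if "w \<in> W" for w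
    using W(1) that unfolding openin_euclidean_subtopology_iff by metis
  have cont_at: "\<exists>r>0. \<forall>v\<in>X. dist v z < r \<longrightarrow> dist (h n v) (h n z) < \<epsilon>" if "0 < \<epsilon>" for \<epsilon> n
    using cont[of n] zX that unfolding continuous_on_iff by metis
  obtain r where r: "0 < r" "\<And>v. v \<in> X \<Longrightarrow> dist v z < r \<Longrightarrow> v \<in> W" using W_nbhd[OF z(1)] by blast
  have "\<exists>m>0. h m z = z"
    using z(2)
  proof (cases rule: recurrent)
    case forward
    \<comment> \<open>\<open>z\<close> and \<open>h m z\<close> both lie in \<open>W\<close>, so their futures are asymptotic; along the returns of \<open>z\<close> they
      converge to \<open>z\<close> and \<open>h m z\<close>.\<close>
    obtain m where m: "m \<ge> 1" "h m z \<in> W" using forward[OF r(1), of 1] r(2) in_X zX by blast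
    have "dist (h m z) z < \<epsilon>" if "0 < \<epsilon>" for \<epsilon>
    proof -
      obtain N where N: "\<And>j z w. \<lbrakk>j \<ge> N; z \<in> W; w \<in> W\<rbrakk> \<Longrightarrow> dist (h j z) (h j w) < \<epsilon> / 3"
        using contract[of "\<epsilon> / 3"] \<open>0 < \<epsilon>\<close> by auto
      obtain s where s: "0 < s" "\<And>v. v \<in> X \<Longrightarrow> dist v z < s \<Longrightarrow> dist (h m v) (h m z) < \<epsilon> / 3"
        using cont_at[of "\<epsilon> / 3" m] \<open>0 < \<epsilon>\<close> by auto
      obtain n where n: "n \<ge> N" "dist (h n z) z < min s (\<epsilon> / 3)"
        using forward[of "min s (\<epsilon> / 3)" N] s(1) \<open>0 < \<epsilon>\<close> by auto
      have "dist (h m (h n z)) (h m z) < \<epsilon> / 3" using s(2) n(2) in_X zX by simp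
      moreover have "dist (h n (h m z)) (h n z) < \<epsilon> / 3" using N n(1) z(1) m(2) by blast
      moreover have "h m (h n z) = h n (h m z)" using add[OF zX, of m n] add[OF zX, of n m] by (simp add: add.commute)
      moreover have "dist (h m z) z \<le> dist (h n (h m z)) (h m z) + dist (h n (h m z)) (h n z) + dist (h n z) z"
        using dist_triangle3[of "h m z" z "h n (h m z)"] dist_triangle[of "h n (h m z)" z "h n z"] by linarith
      ultimately show ?thesis using n(2) by simp
    qed
    then have "h m z = z" by (metis dist_pos_lt less_irrefl)
    then show ?thesis using m(1) by (intro exI[of _ m]) auto
  next
    case backward
    \<comment> \<open>For \<open>n\<close> a late return time in the past, \<open>h (- n) z\<close> and \<open>h (- m - n) z\<close> both lie in \<open>W\<close>; the
      contraction during time \<open>n + m\<close> brings them to \<open>h m z\<close> and \<open>z\<close>.\<close>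
    obtain m where m: "m \<ge> 1" "h (- m) z \<in> W" using backward[OF r(1), of 1] r(2) in_X zX by blast
    obtain r' where r': "0 < r'" "\<And>v. v \<in> X \<Longrightarrow> dist v (h (- m) z) < r' \<Longrightarrow> v \<in> W"
      using W_nbhd[OF m(2)] by blast
    obtain s where s: "0 < s" "\<And>v. v \<in> X \<Longrightarrow> dist v z < s \<Longrightarrow> dist (h (- m) v) (h (- m) z) < r'"
      using cont_at[OF r'(1)] by blast
    have "dist (h m z) z < \<epsilon>" if "0 < \<epsilon>" for \<epsilon>
    proof -
      obtain N where N: "\<And>j z w. \<lbrakk>j \<ge> N; z \<in> W; w \<in> W\<rbrakk> \<Longrightarrow> dist (h j z) (h j w) < \<epsilon>"
        using contract[OF \<open>0 < \<epsilon>\<close>] by blast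
      obtain n where n: "n \<ge> N" "dist (h (- n) z) z < min s r"
        using backward[of "min s r" N] s(1) r(1) by auto
      have "h (- n) z \<in> W" "h (- m) (h (- n) z) \<in> W" using n(2) r r' s in_X zX by auto
      then have "dist (h (n + m) (h (- n) z)) (h (n + m) (h (- m) (h (- n) z))) < \<epsilon>"
        using N n(1) m(1) by auto
      moreover have "h (n + m) (h (- n) z) = h m z" using add[OF zX, of "n + m" "- n"] by simp
      moreover have "h (n + m) (h (- m) (h (- n) z)) = z"
        using add[of "h (- n) z" "n + m" "- m"] act_back in_X zX by simp
      ultimately show ?thesis by simp
    qed
    then have "h m z = z" by (metis dist_pos_lt less_irrefl)
    then show ?thesis using m(1) by (intro exI[of _ m]) auto
  qed
  then show False using aperiodic z(2) by blast
qed

text \<open>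
  The continua \<open>A n\<close> through \<open>y\<close>, whose iterates stay close to those of \<open>y\<close> back to time \<open>- n\<close>,
  decrease to an unstable continuum. It is more than a point unless the \<open>A n\<close> become small. In that
  case consider a continuum \<open>Q\<close> of fixed size around \<open>h (- n) y\<close>. If some iterate of it up to time \<open>n\<close>
  became large, then by boundary bumping a subcontinuum \<open>C\<close> would have an iterate, at a time \<open>j\<close>, that
  is just about to become large; and expansivity puts \<open>j\<close> near \<open>0\<close> or near \<open>n\<close>. Near \<open>0\<close> is excluded,
  as \<open>Q\<close> is small at time \<open>0\<close>, and near \<open>n\<close>, as the iterate at time \<open>n\<close> is inside the small \<open>A n\<close>.
\<close>

lemma unstable_continuum_exists:
  assumes y: "y \<in> X" and "0 < \<kappa>"
  obtains \<Lambda> b where "unstable \<Lambda>" "\<Lambda> \<subseteq> cball y \<kappa>" "y \<in> \<Lambda>" "b \<in> \<Lambda>" "b \<noteq> y"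
proof -
  have c2: "0 < c / 2" using c_pos by simp
  obtain N where "0 \<le> N" and N: "\<And>x y a. \<lbrakk>x \<in> X; y \<in> X; \<And>l. \<bar>l - a\<bar> \<le> N \<Longrightarrow> dist (h l x) (h l y) \<le> c\<rbrakk>
      \<Longrightarrow> dist (h a x) (h a y) < c / 2"
    using uniform_expansivity[OF c2] by metis
  obtain \<rho> where "0 < \<rho>" and \<rho>: "\<And>x y l. \<lbrakk>x \<in> X; y \<in> X; dist x y \<le> \<rho>; \<bar>l\<bar> \<le> N\<rbrakk> \<Longrightarrow> dist (h l x) (h l y) < c / 2"
    using equicontinuous[OF c2 \<open>0 \<le> N\<close>] by metis
  define S where "S n = {z \<in> X. \<forall>j\<in>{- int n..0}. dist (h j z) (h j y) \<le> c / 2}" for n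
  define A where "A n = connected_component_set (S n) y" for n
  have yS: "y \<in> S n" for n using y c2 by (simp add: S_def)
  then have yA: "y \<in> A n" for n by (simp add: A_def)
  have A_sub: "A n \<subseteq> S n" for n by (simp add: A_def connected_component_subset)
  have "compact (S n)" for n
  proof -
    have "closedin (top_of_set X) (\<Inter>j\<in>{- int n..0}. X \<inter> (\<lambda>z. dist (h j z) (h j y)) -` {..c / 2})"
      by (intro closedin_Inter) (auto intro!: continuous_closedin_preimage continuous_on_dist cont continuous_on_const)
    moreover have "(\<Inter>j\<in>{- int n..0}. X \<inter> (\<lambda>z. dist (h j z) (h j y)) -` {..c / 2}) = S n"
      by (auto simp: S_def)
    ultimately show ?thesis using compact_X closedin_compact by metis
  qed
  then have compact_A: "compact (A n)" for n
    unfolding A_def using closedin_connected_component closedin_compact by blast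
  have connected_A: "connected (A n)" for n by (simp add: A_def)
  have dec_A: "decseq A"
    unfolding decseq_def A_def by (intro allI impI connected_component_mono) (auto simp: S_def)
  show thesis
  proof (cases "\<forall>n. \<exists>z\<in>A n. \<rho> \<le> dist z y")
    case True
    have "(\<Inter>n. A n \<inter> {z. \<rho> \<le> dist z y}) \<noteq> {}"
    proof (rule compact_space_imp_nest[of "top_of_set (A 0)"])
      show "compact_space (top_of_set (A 0))" using compact_A by (simp add: compact_space_subtopology)
      have "closed {z. \<rho> \<le> dist z y}" by (intro closed_Collect_le continuous_intros)
      then have "closed (A n \<inter> {z. \<rho> \<le> dist z y})" for n
        using compact_A compact_imp_closed by blast
      moreover have "A n \<subseteq> A 0" for n using dec_A by (simp add: decseq_def)
      ultimately show "closedin (top_of_set (A 0)) (A n \<inter> {z. \<rho> \<le> dist z y})" for n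
        by (intro closed_subset) auto
      show "A n \<inter> {z. \<rho> \<le> dist z y} \<noteq> {}" for n using True by blast
      show "decseq (\<lambda>n. A n \<inter> {z. \<rho> \<le> dist z y})" using dec_A unfolding decseq_def by blast
    qed
    then obtain b where b: "\<And>n. b \<in> A n" "\<rho> \<le> dist b y" by blast
    let ?L = "\<Inter>n. A n"
    have near: "dist (h i z) (h i y) \<le> c / 2" if "z \<in> ?L" "i \<le> 0" for z i
    proof -
      have "z \<in> S (nat (- i))" using that(1) A_sub by blast
      then show ?thesis using that(2) by (simp add: S_def)
    qed
    have "?L \<subseteq> A 0" by auto
    then have "?L \<subseteq> X" using A_sub[of 0] by (auto simp: S_def)
    moreover have "dist (h i x) (h i z) \<le> c" if "x \<in> ?L" "z \<in> ?L" "i \<le> 0" for x z i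
      using near[OF that(1,3)] near[OF that(2,3)] dist_triangle2[of "h i x" "h i z" "h i y"] by linarith
    ultimately have L: "unstable ?L"
      using nested_continua[of A] compact_A connected_A dec_A by (simp add: unstable_def)
    moreover have "b \<noteq> y" using b(2) \<open>0 < \<rho>\<close> by auto
    moreover have "b \<in> ?L" "y \<in> ?L" using b(1) yA by blast+
    ultimately obtain C z where C: "compact C" "connected C" "y \<in> C" "C \<subseteq> ?L \<inter> cball y \<kappa>" "z \<in> C" "min \<kappa> (dist y b) \<le> dist y z"
      using shrink_continuum[of ?L y \<kappa> b] \<open>0 < \<kappa>\<close> unfolding unstable_def by metis
    show ?thesis
    proof (rule that)
      show "unstable C" using L C by (intro unstable_subset[of ?L C]) auto
      show "z \<noteq> y" using C(6) \<open>b \<noteq> y\<close> \<open>0 < \<kappa>\<close> by (auto simp: min_le_iff_disj)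
    qed (use C in auto)
  next
    case False
    then obtain n\<^sub>0 where n0: "\<And>z. z \<in> A n\<^sub>0 \<Longrightarrow> dist z y < \<rho>" by (auto simp: not_le)
    define q where "q n = h (- int n) y" for n
    have qX: "q n \<in> X" for n using y in_X by (simp add: q_def)
    have hq: "h j (q n) = h (j - int n) y" for j n using add[OF y, of j "- int n"] by (simp add: q_def)
    have stable: "dist (h j z) (h j (q n)) \<le> c / 2"
      if n: "n\<^sub>0 \<le> n" and Q: "compact Q" "connected Q" "Q \<subseteq> X" "Q \<subseteq> cball (q n) \<rho>" "q n \<in> Q"
        and z: "z \<in> Q" and j: "j \<in> {0..int n}" for n Q z j
    proof (rule ccontr)
      assume "\<not> ?thesis"
      then have exceed: "c / 2 < dist (h j z) (h j (q n))" by simp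
      obtain C z j where C: "compact C" "connected C" "q n \<in> C" "C \<subseteq> Q"
        "\<And>z j. \<lbrakk>z \<in> C; j \<in> {0..int n}\<rbrakk> \<Longrightarrow> dist (h j z) (h j (q n)) \<le> c / 2"
        and z: "z \<in> C" and j: "j \<in> {0..int n}" and eq: "dist (h j z) (h j (q n)) = c / 2"
        by (rule boundary_bumping_sublevel[of Q "{0..int n}" "\<lambda>j z. dist (h j z) (h j (q n))" "q n" "c / 2" z j])
          (use Q z j exceed c2 in \<open>auto intro!: continuous_on_dist continuous_on_const continuous_on_subset[OF cont]\<close>)
      have zX: "z \<in> X" using C Q z by blast
      have "h (int n) ` C \<subseteq> A n"
        unfolding A_def
      proof (rule connected_component_maximal)
        show "y \<in> h (int n) ` C" using C(3) hq[of "int n" n] zero y by (metis diff_self image_eqI)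
        show "connected (h (int n) ` C)"
          using C Q by (intro connected_continuous_image continuous_on_subset[OF cont]) auto
        have "dist (h i (h (int n) w)) (h i y) \<le> c / 2" if "w \<in> C" "i \<in> {- int n..0}" for w i
        proof -
          have "w \<in> X" using that C Q by blast
          then show ?thesis using C(5)[of w "i + int n"] that add[of w i "int n"] hq[of "i + int n" n] by simp
        qed
        then show "h (int n) ` C \<subseteq> S n" using C Q in_X by (auto simp: S_def)
      qed
      also have "A n \<subseteq> A n\<^sub>0" using dec_A n by (simp add: decseq_def)
      finally have near_y: "dist (h (int n) z) y < \<rho>" using z n0 by blast
      obtain l where l: "\<bar>l - j\<bar> \<le> N" "c < dist (h l z) (h l (q n))"
        using N[of z "q n" j] zX qX eq by fastforce
      then have "l \<notin> {0..int n}" using C(5)[OF z, of l] c_pos by auto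
      then consider "\<bar>j\<bar> \<le> N" | "\<bar>j - int n\<bar> \<le> N" using l(1) j by fastforce
      then show False
      proof cases
        case 1
        have "dist z (q n) \<le> \<rho>" using z C(4) Q(4) by (auto simp: dist_commute)
        then show False using \<rho>[OF zX qX _ 1, of n] eq by simp
      next
        case 2
        have "dist (h (int n) z) y \<le> \<rho>" using near_y by simp
        then have "dist (h (j - int n) (h (int n) z)) (h (j - int n) y) < c / 2"
          using \<rho>[OF in_X[OF zX] y _ 2] by blast
        then show False using eq hq[of j n] add[OF zX, of "j - int n" "int n"] by simp
      qed
    qed
    \<comment> \<open>A connected neighbourhood \<open>W\<close> of a limit point of the \<open>q n\<close> serves as \<open>Q\<close> for infinitely many \<open>n\<close>,
      so that all its future iterates are small.\<close>
    obtain p r where p: "p \<in> X" and "strict_mono r" and lim: "(q \<circ> r) \<longlonglongrightarrow> p"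
      using compact_imp_seq_compact[OF compact_X] qX seq_compactE[of X q] by metis
    have "p \<in> X \<inter> ball p (\<rho> / 2)" using p \<open>0 < \<rho>\<close> by simp
    then obtain W where W: "openin (top_of_set X) W" "connected W" "p \<in> W" "W \<subseteq> X \<inter> ball p (\<rho> / 2)"
      using locally_connected_X openin_open_Int[OF open_ball] unfolding locally_connected by metis
    have closure_W: "closure W \<subseteq> X \<inter> cball p (\<rho> / 2)"
      using W(4) compact_X by (intro closure_minimal) (auto intro: compact_imp_closed)
    then have "compact (closure W)"
      using compact_X compact_Int_closed[of X "closure W"] by (simp add: inf.absorb2)
    have "dist (h j z) (h j w) \<le> c" if "z \<in> W" "w \<in> W" "0 \<le> j" for z w j
    proof -
      obtain T where T: "open T" "W = X \<inter> T" using W(1) by (auto simp: openin_open)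
      have "\<forall>\<^sub>F i in sequentially. q (r i) \<in> T"
        using topological_tendstoD[OF lim T(1)] W(3) T(2) by simp
      then obtain i where i: "max n\<^sub>0 (nat j) \<le> i" "q (r i) \<in> T"
        using eventually_ge_at_top[of "max n\<^sub>0 (nat j)"] eventually_happens eventually_conj
          sequentially_bot by (metis (mono_tags, lifting))
      have late: "max n\<^sub>0 (nat j) \<le> r i" using i(1) seq_suble[OF \<open>strict_mono r\<close>, of i] by linarith
      have qW: "q (r i) \<in> W" using i(2) T(2) qX by blast
      have W_ball: "closure W \<subseteq> cball (q (r i)) \<rho>"
      proof
        fix v assume "v \<in> closure W"
        then have "dist p v \<le> \<rho> / 2" "dist p (q (r i)) \<le> \<rho> / 2" using closure_W W(4) qW by auto
        then show "v \<in> cball (q (r i)) \<rho>" using dist_triangle3[of "q (r i)" v p] by simp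
      qed
      have "dist (h j v) (h j (q (r i))) \<le> c / 2" if "v \<in> W" for v
      proof (rule stable[of "r i" "closure W"])
        show "connected (closure W)" using W(2) by (rule connected_imp_connected_closure)
        show "q (r i) \<in> closure W" "v \<in> closure W" using qW that closure_subset by blast+
        show "closure W \<subseteq> X" using closure_W by blast
      qed (use late W_ball \<open>compact (closure W)\<close> \<open>0 \<le> j\<close> in auto)
      from this[OF \<open>z \<in> W\<close>] this[OF \<open>w \<in> W\<close>] show ?thesis
        using dist_triangle2[of "h j z" "h j w" "h j (q (r i))"] by linarith
    qed
    then show ?thesis using no_stable_open_set[of W] W by blast
  qed
qed

section \<open>A point that is not recurrent\<close>

lemma recurrent_visits:
  assumes x: "dense_orbit x" and returns: "\<And>r N. 0 < r \<Longrightarrow> \<exists>n\<ge>N. dist (h n x) x < r"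
    and p: "p \<in> X" "0 < r"
  shows "\<exists>n\<ge>N. dist (h n x) p < r"
proof -
  have xX: "x \<in> X" using x by (simp add: dense_orbit_def)
  have "openin (top_of_set X) (X \<inter> ball p r)" "X \<inter> ball p r \<noteq> {}" using p by (auto simp: openin_open_Int)
  then obtain i where "h i x \<in> X \<inter> ball p r" by (rule dense_orbit_meets[OF x])
  then have i: "0 < r - dist (h i x) p" by (simp add: dist_commute)
  obtain s where s: "0 < s" "\<And>v. v \<in> X \<Longrightarrow> dist v x < s \<Longrightarrow> dist (h i v) (h i x) < r - dist (h i x) p"
    using cont[of i] xX i unfolding continuous_on_iff by metis
  obtain n where n: "n \<ge> N - i" "dist (h n x) x < s" using returns[OF s(1)] by blast
  then have "dist (h i (h n x)) (h i x) < r - dist (h i x) p" using s(2) in_X xX by blast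
  then have "dist (h (i + n) x) p < r"
    using add[OF xX, of i n] dist_triangle[of "h i (h n x)" p "h i x"] by simp
  then show ?thesis using n(1) by (intro exI[of _ "i + n"]) auto
qed

lemma inconsistent: False
proof -
  interpret rev: quasi_minimal_action X "\<lambda>n. h (- n)" c U by (rule quasi_minimal_reversed)
  have U_sub: "U \<subseteq> X" using open_U openin_imp_subset by blast
  have U_nbhd: "\<exists>\<kappa>>0. X \<inter> cball z \<kappa> \<subseteq> U" if z: "z \<in> U" for z
  proof -
    obtain e where "0 < e" "\<And>v. v \<in> X \<Longrightarrow> dist v z < e \<Longrightarrow> v \<in> U"
      using open_U z unfolding openin_euclidean_subtopology_iff by metis
    then show ?thesis by (intro exI[of _ "e / 2"]) (auto simp: dist_commute)
  qed
  obtain p where "p \<in> U" using U_ne by blast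
  then have p: "p \<in> X" "\<And>m. 0 < m \<Longrightarrow> h m p \<noteq> p" "\<And>m. 0 < m \<Longrightarrow> h (- m) p \<noteq> p"
    using U_sub aperiodic dense_orbit_U rev.aperiodic rev.dense_orbit_U by auto
  obtain \<kappa> where \<kappa>: "0 < \<kappa>" "X \<inter> cball p \<kappa> \<subseteq> U" using U_nbhd[OF \<open>p \<in> U\<close>] by blast
  \<comment> \<open>The continuum has to stay in \<open>U\<close>, so that the point found in it has a dense orbit again.\<close>
  obtain \<Lambda> b where \<Lambda>: "rev.unstable \<Lambda>" "\<Lambda> \<subseteq> cball p \<kappa>" "p \<in> \<Lambda>" "b \<in> \<Lambda>" "b \<noteq> p"
    using rev.unstable_continuum_exists[OF p(1) \<kappa>(1)] .
  obtain y r T where y: "y \<in> \<Lambda>" "0 < r" "\<And>t. T \<le> t \<Longrightarrow> r \<le> dist (h (- t) y) p"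
    using rev.unstable_avoids_ball[OF p(1,3) \<Lambda>(1,3-5)] by blast
  have "y \<in> U" using \<Lambda>(1,2) y(1) \<kappa>(2) by (auto simp: rev.unstable_def)
  then have yX: "y \<in> X" using U_sub by blast
  obtain \<kappa>' where \<kappa>': "0 < \<kappa>'" "X \<inter> cball y \<kappa>' \<subseteq> U" using U_nbhd[OF \<open>y \<in> U\<close>] by blast
  obtain \<Lambda>' b' where \<Lambda>': "unstable \<Lambda>'" "\<Lambda>' \<subseteq> cball y \<kappa>'" "y \<in> \<Lambda>'" "b' \<in> \<Lambda>'" "b' \<noteq> y"
    using unstable_continuum_exists[OF yX \<kappa>'(1)] .
  obtain x r' T' where x: "x \<in> \<Lambda>'" "0 < r'" "\<And>t. T' \<le> t \<Longrightarrow> r' \<le> dist (h t x) p"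
    using unstable_avoids_ball[OF p(1,2) \<Lambda>'(1,3-5)] by blast
  have "x \<in> U" using \<Lambda>'(1,2) x(1) \<kappa>'(2) by (auto simp: unstable_def)
  then have xX: "x \<in> X" using U_sub by blast
  show False
    using dense_orbit_U[OF \<open>x \<in> U\<close>]
  proof (cases rule: recurrent)
    case forward
    then obtain n where "n \<ge> T'" "dist (h n x) p < r'"
      using recurrent_visits[OF dense_orbit_U[OF \<open>x \<in> U\<close>] _ p(1) x(2)] by blast
    then show False using x(3) by fastforce
  next
    case backward
    have "0 < r / 2" using y(2) by simp
    obtain N where N: "0 \<le> N" "\<And>x y a. \<lbrakk>x \<in> X; y \<in> X; \<And>l. \<bar>l - a\<bar> \<le> N \<Longrightarrow> dist (h l x) (h l y) \<le> c\<rbrakk>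
        \<Longrightarrow> dist (h a x) (h a y) < r / 2"
      using uniform_expansivity[OF \<open>0 < r / 2\<close>] by metis
    obtain n where n: "n \<ge> max N T" "dist (h (- n) x) p < r / 2"
      using rev.recurrent_visits[OF rev.dense_orbit_U[OF \<open>x \<in> U\<close>] backward p(1) \<open>0 < r / 2\<close>] by blast
    have "dist (h (- n) x) (h (- n) y) < r / 2"
      using n(1) \<Lambda>'(1,3) x(1) by (intro N(2)[OF xX yX]) (auto simp: unstable_def)
    then have "dist (h (- n) y) p < r"
      using n(2) dist_triangle3[of "h (- n) y" p "h (- n) x"] by linarith
    then show False using y(3)[of n] n(1) by simp
  qed
qed

end

section \<open>Integer iterates of a homeomorphism\<close>

lemma int_iterate_homeomorphism:
  fixes X :: "'a::metric_space set"
  assumes "homeomorphism X X f g"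
  shows "x \<in> X \<Longrightarrow> int_iterate X f n x \<in> X"
    and "x \<in> X \<Longrightarrow> int_iterate X f 0 x = x"
    and "x \<in> X \<Longrightarrow> int_iterate X f (m + n) x = int_iterate X f m (int_iterate X f n x)"
    and "continuous_on X (int_iterate X f n)"
proof -
  let ?h = "int_iterate X f"
  have fg: "\<And>x. x \<in> X \<Longrightarrow> f x \<in> X" "\<And>x. x \<in> X \<Longrightarrow> g x \<in> X"
    "\<And>x. x \<in> X \<Longrightarrow> g (f x) = x" "\<And>x. x \<in> X \<Longrightarrow> f (g x) = x" and cont: "continuous_on X f" "continuous_on X g"
    using assms by (auto simp: homeomorphism_def)
  have "inj_on f X" using fg(3) by (metis inj_on_inverseI)
  then have inv: "inv_into X f x = g x" if "x \<in> X" for x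
    using fg that by (intro inv_into_f_eq) auto
  have zero: "?h 0 x = x" for x by (simp add: int_iterate_def)
  have in_X: "?h n x \<in> X" if "x \<in> X" for n x
  proof -
    have "(f ^^ k) x \<in> X" "(inv_into X f ^^ k) x \<in> X" for k
      using that fg inv by (induction k) auto
    then show ?thesis by (simp add: int_iterate_def)
  qed
  have suc: "?h (n + 1) x = f (?h n x)" if "x \<in> X" for n x
  proof (cases "0 \<le> n")
    case True
    then show ?thesis by (simp add: int_iterate_def nat_add_distrib)
  next
    case False
    define m where "m = nat (- n) - 1"
    have m: "nat (- n) = Suc m" "n = - int (Suc m)" using False by (auto simp: m_def)
    have "?h (- int m) x \<in> X" using in_X that by blast
    moreover have "?h (- int m) x = (inv_into X f ^^ m) x" by (auto simp: int_iterate_def)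
    moreover have "?h n x = inv_into X f ((inv_into X f ^^ m) x)"
      using False m(1) by (simp add: int_iterate_def)
    ultimately have "f (?h n x) = ?h (- int m) x" using inv fg by simp
    then show ?thesis using m(2) by simp
  qed
  have pre: "?h (n - 1) x = g (?h n x)" if "x \<in> X" for n x
    using suc[OF that, of "n - 1"] fg in_X that by simp
  show "x \<in> X \<Longrightarrow> ?h n x \<in> X" "x \<in> X \<Longrightarrow> ?h 0 x = x" using in_X zero by auto
  show "?h (m + n) x = ?h m (?h n x)" if "x \<in> X"
  proof (induction m rule: int_induct[of _ 0])
    case (step1 i)
    then show ?case using suc[OF that, of "i + n"] suc[OF in_X[OF that], of i n] by (simp add: algebra_simps)
  next
    case (step2 i)
    then show ?case using pre[OF that, of "i + n"] pre[OF in_X[OF that], of i n] by (simp add: algebra_simps)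
  qed (simp add: zero)
  show "continuous_on X (?h n)"
  proof (induction n rule: int_induct[of _ 0])
    case base
    show ?case by (rule continuous_on_eq[OF continuous_on_id]) (simp add: zero)
  next
    case (step1 i)
    have "continuous_on X (\<lambda>x. f (?h i x))"
      by (rule continuous_on_compose2[OF cont(1) step1(2)]) (use in_X in blast)
    then show ?case by (rule continuous_on_eq) (simp add: suc)
  next
    case (step2 i)
    have "continuous_on X (\<lambda>x. g (?h i x))"
      by (rule continuous_on_compose2[OF cont(2) step2(2)]) (use in_X in blast)
    then show ?case by (rule continuous_on_eq) (simp add: pre)
  qed
qed

theorem theorem2p2:
  fixes X :: "'a::metric_space set" and f :: "'a \<Rightarrow> 'a"
  assumes nontrivial: "infinite X"
    and "compact X"
    and "locally connected X"
    and homeo: "\<exists>g. homeomorphism X X f g"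
    and "expansive_on X f"
  shows "\<not> quasi_minimal_on X f"
proof
  assume "quasi_minimal_on X f"
  then obtain U where U: "openin (top_of_set X) U" "U \<noteq> {}" "\<And>x. x \<in> U \<Longrightarrow> X \<subseteq> closure (orbit_on X f x)"
    unfolding quasi_minimal_on_def by blast
  obtain g where g: "homeomorphism X X f g" using homeo by blast
  obtain e where "0 < e" and e: "\<And>x y. \<lbrakk>x \<in> X; y \<in> X; x \<noteq> y\<rbrakk> \<Longrightarrow>
      ereal e \<le> (SUP n. ereal (dist (int_iterate X f n x) (int_iterate X f n y)))"
    using \<open>expansive_on X f\<close> unfolding expansive_on_def by metis
  \<comment> \<open>The supremum in the hypothesis need not be attained, which is why the constant is halved.\<close>
  have "x = y" if "x \<in> X" "y \<in> X" and close: "\<And>n. dist (int_iterate X f n x) (int_iterate X f n y) \<le> e / 2" for x y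
  proof (rule ccontr)
    assume "x \<noteq> y"
    then have "ereal e \<le> (SUP n. ereal (dist (int_iterate X f n x) (int_iterate X f n y)))"
      using e that by blast
    also have "\<dots> \<le> ereal (e / 2)" using close by (intro SUP_least) simp
    finally show False using \<open>0 < e\<close> by simp
  qed
  then interpret quasi_minimal_action X "int_iterate X f" "e / 2" U
    using assms U \<open>0 < e\<close> int_iterate_homeomorphism[OF g]
    by unfold_locales (auto simp: orbit_on_def)
  show False by (rule inconsistent)
qed

end
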